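(* (Workload preservation of $\delta$.) Let $\Gamma;\dot\Gamma\vdash e:(\tau;\sigma)$ be a Linear A judgment and $\theta$ an enumeration of $\dot\Gamma$. Then the $\lambda LL$ term $\delta_\theta(e)$ is safe and $\mathcal W(\delta_\theta(e))\le\mathcal W^{\mathrm{Jax}}(e)$, where $\mathcal W$ is the workload of $\lambda LL$ terms and $\mathcal W^{\mathrm{Jax}}$ the workload of Linear A expressions.
   Context: **Calculus $\lambda LL$.** Fix function symbols $\underline f$ with arities $n\ge 1$, each denoting a differentiable $f:\mathbb R^n\to\mathbb R$. Types: $A,B::=\mathbb R\mid A\multimap B\mid 1\mid A\otimes B\mid\top\mid A\& B\mid {!A}$. Each variable has a fixed type. Patterns: $p,q::=x\mid {!x}\mid ()\mid (p,q)\mid\langle p,q\rangle$, no variable repeated, typed by $x:A$, $!x:{!A}$ (for $x$ of type $A$), $():1$, $(p,q):A\otimes B$, $\langle p,q\rangle:A\& B$. Terms: $M,N::=x\mid {!M}\mid\lambda p.M\mid MN\mid ()\mid (M,N)\mid\langle\rangle\mid\langle M,N\rangle\mid\underline r\mid\underline f\mid\dot+\mid\dot*$ ($r\in\mathbb R$); the constants have types $\underline r:\mathbb R$, $\underline f:({!\mathbb R}\otimes\dots\otimes{!\mathbb R})\multimap{!\mathbb R}$, $\dot+:\mathbb R\&\mathbb R\multimap\mathbb R$, $\dot*:\mathbb R\multimap\mathbb R\multimap\mathbb R$, and typing follows intuitionistic linear logic (with $!x$ patterns duplicable/erasable). **Workload.** $\mathcal W(A)$ is the number of occurrences of $\mathbb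 R$ in the type $A$ not under a $!$. On terms: $\mathcal W(\underline f)=\mathcal W(\dot+)=\mathcal W(\dot* )=1$; $\mathcal W(x)=\mathcal W(!M)=\mathcal W(())=\mathcal W(\langle\rangle)=\mathcal W(\underline r)=0$; $\mathcal W(\lambda p.M)=\mathcal W(M)+\sum_{x:A\,\in\,FV(p)\setminus FV(M)}\mathcal W(A)$; $\mathcal W(MN)=\mathcal W((M,N))=\mathcal W(\langle M,N\rangle)=\mathcal W(M)+\mathcal W(N)$. **Safe term.** A variable is ground if its type contains no $\multimap$. A term $M$ is safe if (i) for every subterm $!M'$ of $M$, $\mathcal W(M')=0$; (ii) for every subterm $\langle M_1,M_2\rangle$ of $M$, $FV(M_1)\cap FV(M_2)$ contains only ground variables. **Abbreviations.** $\mathtt{let}\ p=N\ \mathtt{in}\ M:=(\lambda p.M)N$; $\S A:=1\& A$ and $\S M:=\langle(),M\rangle$ for terms and patterns $M$. $n$-ary tuples $\langle M_1,\dots,M_n\rangle$ (and $A_1\&\dots\& A_n$, and tuple patterns) are right-nested; the $1$-ary tuple is its component; the empty tuple is $\langle\rangle$, the empty $\&$ is $\top$, and the empty tuple pattern is a fresh variable of type $\top$. For types $H$ built from $\mathbb R,\top,\&$: $\underline0_{\mathbb R}=\underline0$, $\underline0_\top=\langle\rangle$, $\underline0_{H\& H'}=\langle\underline0_H,\underline0_{H'}\rangle$; $\dot+_{\mathbb R}=\dot+$, $\dot+_\top=\lambda\langle h,h'\rangle.\langle\rangle$, $\dot+_{H\& K}=\lambda\langle\langle h,k\rangle,\langle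 h',k'\rangle\rangle.\langle\dot+_H\langle h,h'\rangle,\dot+_K\langle k,k'\rangle\rangle$; for a variable $x:\mathbb R$: $\dot*_{\mathbb R}x=\dot*x$, $\dot*_\top x=\lambda h.\langle\rangle$, $\dot*_{H\& K}x=\lambda\langle h,k\rangle.\langle(\dot*_Hx)h,(\dot*_Kx)k\rangle$. **Linear A.** Types $\tau,\sigma::=\mathbb R\mid1\mid\tau\otimes\sigma$. There are primal variables $x,z,\dots$ and tangent variables $\dot x,\dot y,\dots$, with fixed types. Judgments $\Gamma;\dot\Gamma\vdash e:(\tau;\sigma)$ ($\Gamma$ primal context, $\dot\Gamma$ tangent context; comma = disjoint union, $\cup$ = union): - $x:\tau;\dot y:\sigma\vdash(x;\dot y):(\tau;\sigma)$; - $\Gamma_1;\dot\Gamma_1\vdash e_1:(\tau_1;\sigma_1)$ and $\Gamma_2,x:\tau_1;\dot\Gamma_2,\dot y:\sigma_1\vdash e_2:(\tau;\sigma)$ give $\Gamma_1\cup\Gamma_2;\dot\Gamma_1,\dot\Gamma_2\vdash\mathtt{let}\,(x;\dot y)=e_1\,\mathtt{in}\,e_2:(\tau;\sigma)$; - $;\vdash\otimes():(1;1)$; $;\vdash\dot\otimes():(1;1)$; - $\Gamma;\dot\Gamma\vdash e:(\tau;\sigma)$ gives $\Gamma,z:1;\dot\Gamma\vdash\mathtt{let}\otimes()=z\,\mathtt{in}\,e:(\tau;\sigma)$ and $\Gamma;\dot\Gamma,\dot z:1\vdash\mathtt{let}\,\dot\otimes()=\dot z\,\mathtt{in}\,e:(\tau;\sigma)$;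 - $;\dot x_1:\tau_1,\dot x_2:\tau_2\vdash\dot\otimes(\dot x_1,\dot x_2):(1;\tau_1\otimes\tau_2)$; $\Gamma;\dot\Gamma,\dot x_1:\tau_1,\dot x_2:\tau_2\vdash e:(\tau;\sigma)$ gives $\Gamma;\dot\Gamma,\dot z:\tau_1\otimes\tau_2\vdash\mathtt{let}\,\dot\otimes(\dot x_1,\dot x_2)=\dot z\,\mathtt{in}\,e:(\tau;\sigma)$; - $;\vdash\dot0_\tau:(1;\tau)$; $;\dot x:\tau,\dot y:\tau\vdash\dot x\,\dot+\,\dot y:(1;\tau)$; $x:\mathbb R;\dot y:\tau\vdash x\,\dot*\,\dot y:(1;\tau)$; $;\vdash\underline r:(\mathbb R;1)$; $x_1:\mathbb R,\dots,x_n:\mathbb R;\vdash\underline f(x_1,\dots,x_n):(\mathbb R;1)$; $;\dot x:\tau\vdash\mathrm{dup}(\dot x):(1;\tau\otimes\tau)$; $\Gamma;\dot\Gamma\vdash e:(\tau;\sigma)$ gives $\Gamma;\dot\Gamma\vdash\mathrm{drop}(e):(1;1)$. $FV^t(e)$ is the set of free tangent variables of $e$. **Workload of Linear A.** $\mathcal W^{\mathrm{Jax}}(\tau)$ is the number of occurrences of $\mathbb R$ in $\tau$. On expressions: $\mathcal W^{\mathrm{Jax}}(\underline f(x_1,\dots,x_n))=\mathcal W^{\mathrm{Jax}}(\underline r)=1$; $\mathcal W^{\mathrm{Jax}}(\dot0_\tau)=1+\mathcal W^{\mathrm{Jax}}(\tau)$; $\mathcal W^{\mathrm{Jax}}(\dot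 x\dot+\dot y)=\mathcal W^{\mathrm{Jax}}(x\dot*\dot y)=\mathcal W^{\mathrm{Jax}}(\tau)$ when the result has tangent type $\tau$; $\mathcal W^{\mathrm{Jax}}(\mathrm{drop}(e))=\mathcal W^{\mathrm{Jax}}(e)+\mathcal W^{\mathrm{Jax}}(\tau)+\mathcal W^{\mathrm{Jax}}(\sigma)$ for $e:(\tau;\sigma)$; $\mathcal W^{\mathrm{Jax}}(\mathtt{let}\,(x;\dot y)=e_1\,\mathtt{in}\,e_2)=\mathcal W^{\mathrm{Jax}}(e_1)+\mathcal W^{\mathrm{Jax}}(e_2)$; the other $\mathtt{let}$'s cost $\mathcal W^{\mathrm{Jax}}$ of their body $e$; all remaining expressions cost $0$. **Translation of types.** $\mathsf p(\mathbb R)=\mathbb R$, $\mathsf p(1)=1$, $\mathsf p(\tau\otimes\sigma)={!\mathsf p(\tau)}\otimes{!\mathsf p(\sigma)}$; $\mathsf t(\mathbb R)=\mathbb R$, $\mathsf t(1)=\top$, $\mathsf t(\tau\otimes\sigma)=\mathsf t(\tau)\&\mathsf t(\sigma)$. **Translation $\delta$.** For $\Gamma;\dot\Gamma\vdash e:(\tau;\sigma)$ and an enumeration $\theta$ of $\dot\Gamma=FV^t(e)$, $\delta_\theta(e)$ has type ${!\mathsf p(\tau)}\otimes\S((\&_{\dot y:\sigma'\in\theta}\mathsf t(\sigma'))\multimap\mathsf t(\sigma))$ in the environment $\{!x:{!\mathsf p(\tau')}\mid x:\tau'\in\Gamma\}$ (primal variables are used as $\lambda LL$ variables of type $\mathsf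 p(\tau')$). Write $u_\theta=\langle u_{\dot y}\rangle_{\dot y\in\theta}$ for a tuple (pattern) of fresh variables $u_{\dot y}:\mathsf t(\sigma')$, for $\dot y:\sigma'$ in $\theta$, and $\theta\cap X$, $\theta\setminus\dot z$ for the corresponding sublists. - $\delta_\theta((x;\dot y))=(!x,\S(\lambda u_\theta.u_{\dot y}))$; - $\delta_\theta(\mathtt{let}\,(x;\dot y)=e_1\,\mathtt{in}\,e_2)=\mathtt{let}\,(!x,\S f)=\delta_{\theta_1}(e_1)\,\mathtt{in}\,\mathtt{let}\,(!z,\S g)=\delta_{\dot y,\theta_2}(e_2)\,\mathtt{in}\,(!z,\S(\lambda u_\theta.\,g\langle f\,u_{\theta_1},u_{\dot w}\rangle_{\dot w\in\theta_2}))$, where $\theta_i=\theta\cap FV^t(e_i)$ and the argument of $g$ is the tuple with first component $f\,u_{\theta_1}$ followed by $u_{\dot w}$, $\dot w\in\theta_2$; - $\delta_\theta(\otimes())=\delta_\theta(\dot\otimes())=(!(),\S(\lambda y^\top.\langle\rangle))$; $\delta_\theta(\mathtt{let}\otimes()=z\,\mathtt{in}\,e)=\mathtt{let}\,()=z\,\mathtt{in}\,\delta_\theta(e)$; - $\delta_\theta(\mathtt{let}\,\dot\otimes()=\dot z\,\mathtt{in}\,e)=\mathtt{let}\,(!x,\S f)=\delta_{\theta\setminus\dot z}(e)\,\mathtt{in}\,(!x,\S(\lambda u_\theta.f\,u_{\theta\setminus\dot z}))$; - $\delta_\theta(\dot\otimes(\dot x_1,\dot x_2))=(!(),\S(\lambda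 u_\theta.\langle u_{\dot x_1},u_{\dot x_2}\rangle))$; - $\delta_\theta(\mathtt{let}\,\dot\otimes(\dot x_1,\dot x_2)=\dot z\,\mathtt{in}\,e)=\mathtt{let}\,(!x,\S f)=\delta_{\dot x_1,\dot x_2,\theta\setminus\dot z}(e)\,\mathtt{in}\,(!x,\S(\lambda u_\theta[\langle x_1,x_2\rangle/u_{\dot z}].\,f\langle x_1,x_2,u_{\dot w}\rangle_{\dot w\in\theta\setminus\dot z}))$, where $u_\theta[\langle x_1,x_2\rangle/u_{\dot z}]$ is the pattern $u_\theta$ with $u_{\dot z}$ replaced by $\langle x_1,x_2\rangle$; - $\delta_\theta(\underline r)=(!\underline r,\S(\lambda y^\top.\langle\rangle))$; $\delta_\theta(\underline f(x_1,\dots,x_n))=(\underline f(!x_1,\dots,!x_n),\S(\lambda y^\top.\langle\rangle))$; $\delta_\theta(\dot0_\sigma)=(!(),\S(\lambda y^\top.\underline0_{\mathsf t(\sigma)}))$; - for $\dot y_1,\dot y_2,\dot y:\tau$: $\delta_\theta(\dot y_1\dot+\dot y_2)=(!(),\S(\lambda u_\theta.\dot+_{\mathsf t(\tau)}\langle u_{\dot y_1},u_{\dot y_2}\rangle))$; $\delta_\theta(x\dot*\dot y)=(!(),\S(\lambda u_\theta.(\dot*_{\mathsf t(\tau)}x)u_{\dot y}))$; $\delta_\theta(\mathrm{dup}(\dot y))=(!(),\S(\lambda u_\theta.\langle u_{\dot y},u_{\dot y}\rangle))$; - $\delta_\theta(\mathrm{drop}(e))=\mathtt{let}\,(!x,\S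 f)=\delta_\theta(e)\,\mathtt{in}\,(!(),\S(\lambda y.\mathtt{let}\ z=f\,y\ \mathtt{in}\,\langle\rangle))$.
   Formalization: In W(λp.M), an erased x bound by !x is charged W(!A)=0 instead of W(A); with W(A) the bound fails when x scales a tangent of a type without ℝ. With W(A), safety is proved always, and the bound when every scaling x*y has y of a type containing ℝ. *)

theory Defs
  imports Complex_Main
begin

section \<open>Signatures of function symbols\<close>

text \<open>Since the arity is a value and not a type, a function of \<open>n\<close> real arguments is represented on
  \<open>nat \<Rightarrow> real\<close>, of which only the coordinates \<open>i < n\<close> matter; differentiability is Frechet
  differentiability at every point, with gradient \<open>a\<close>.\<close>

definition differentiable_fun :: "nat \<Rightarrow> ((nat \<Rightarrow> real) \<Rightarrow> real) \<Rightarrow> bool" where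
  "differentiable_fun n F \<longleftrightarrow>
     (\<forall>x y. (\<forall>i<n. x i = y i) \<longrightarrow> F x = F y) \<and>
     (\<forall>x. \<exists>a. \<forall>\<epsilon>>0. \<exists>\<delta>>0. \<forall>h. (\<forall>i<n. \<bar>h i\<bar> < \<delta>) \<longrightarrow>
        \<bar>F (\<lambda>i. x i + h i) - F x - (\<Sum>i<n. a i * h i)\<bar> \<le> \<epsilon> * (\<Sum>i<n. \<bar>h i\<bar>))"

definition signature :: "('f \<Rightarrow> nat) \<Rightarrow> ('f \<Rightarrow> (nat \<Rightarrow> real) \<Rightarrow> real) \<Rightarrow> bool" where
  "signature ar den \<longleftrightarrow> (\<forall>f. 1 \<le> ar f \<and> differentiable_fun (ar f) (den f))"


section \<open>The calculus \<open>\<lambda>LL\<close>\<close>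

datatype ty = TReal | Lolli ty ty | TOne | TTensor ty ty | TTop | TWith ty ty | TBang ty

text \<open>The countable set of names is split into three disjoint supplies: images of primal variables,
  the variables \<open>u\<^bsub>y\<^esub>\<close> attached to tangent variables \<open>y\<close>, and auxiliary names. The fresh variables
  required by the translation can then be chosen by fixed names. A variable consists of its name and
  its type. Patterns and terms are raw syntax: typing and linearity of patterns are not built in, as
  workload and safety do not refer to them.\<close>

datatype name = Primal nat | Tangent nat | Aux nat

datatype var = Var name (vty: ty)

datatype pat = PVar var | PBang var | PUnit | PTensor pat pat | PWith pat pat

datatype 'f tm =
    V var
  | Bang "'f tm"
  | Lam pat "'f tm"
  | App "'f tm" "'f tm"
  | Unit
  | Tensor "'f tm" "'f tm"
  | Top
  | With "'f tm" "'f tm"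
  | Num real
  | Fn 'f
  | Plus
  | Times

primrec fvp :: "pat \<Rightarrow> var set" where
  "fvp (PVar x) = {x}"
| "fvp (PBang x) = {x}"
| "fvp PUnit = {}"
| "fvp (PTensor p q) = fvp p \<union> fvp q"
| "fvp (PWith p q) = fvp p \<union> fvp q"

primrec fv :: "'f tm \<Rightarrow> var set" where
  "fv (V x) = {x}"
| "fv (Bang M) = fv M"
| "fv (Lam p M) = fv M - fvp p"
| "fv (App M N) = fv M \<union> fv N"
| "fv Unit = {}"
| "fv (Tensor M N) = fv M \<union> fv N"
| "fv Top = {}"
| "fv (With M N) = fv M \<union> fv N"
| "fv (Num r) = {}"
| "fv (Fn f) = {}"
| "fv Plus = {}"
| "fv Times = {}"

primrec subterms :: "'f tm \<Rightarrow> 'f tm set" where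
  "subterms (V x) = {V x}"
| "subterms (Bang M) = insert (Bang M) (subterms M)"
| "subterms (Lam p M) = insert (Lam p M) (subterms M)"
| "subterms (App M N) = insert (App M N) (subterms M \<union> subterms N)"
| "subterms Unit = {Unit}"
| "subterms (Tensor M N) = insert (Tensor M N) (subterms M \<union> subterms N)"
| "subterms Top = {Top}"
| "subterms (With M N) = insert (With M N) (subterms M \<union> subterms N)"
| "subterms (Num r) = {Num r}"
| "subterms (Fn f) = {Fn f}"
| "subterms Plus = {Plus}"
| "subterms Times = {Times}"


subsection \<open>Workload and safety\<close>

primrec workload_ty :: "ty \<Rightarrow> nat" where
  "workload_ty TReal = 1"
| "workload_ty (Lolli A B) = workload_ty A + workload_ty B"
| "workload_ty TOne = 0"
| "workload_ty (TTensor A B) = workload_ty A + workload_ty B"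
| "workload_ty TTop = 0"
| "workload_ty (TWith A B) = workload_ty A + workload_ty B"
| "workload_ty (TBang A) = 0"

text \<open>The workload of \<open>\<lambda>p. M\<close> charges \<open>workload_ty A\<close> for every \<open>x : A\<close> in \<open>p\<close> that \<open>M\<close> erases.
  For \<open>x\<close> bound by a pattern \<open>!x\<close> there are two ways to read \<open>x : A\<close>. In \<open>pat_env\<close> the variable is
  typed as in the environment, i.e. by \<open>!A\<close>, so that erasing it is free. In \<open>pat_vars\<close> it
  has the type of the bare variable, so that erasing it costs \<open>workload_ty A\<close>. The function \<open>E\<close> below is one of the two.\<close>

primrec pat_env :: "pat \<Rightarrow> (var \<times> ty) set" where
  "pat_env (PVar x) = {(x, vty x)}"
| "pat_env (PBang x) = {(x, TBang (vty x))}"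
| "pat_env PUnit = {}"
| "pat_env (PTensor p q) = pat_env p \<union> pat_env q"
| "pat_env (PWith p q) = pat_env p \<union> pat_env q"

definition pat_vars :: "pat \<Rightarrow> (var \<times> ty) set" where
  "pat_vars p = {(x, vty x) | x. x \<in> fvp p}"

primrec workload_of :: "(pat \<Rightarrow> (var \<times> ty) set) \<Rightarrow> 'f tm \<Rightarrow> nat" where
  "workload_of E (V x) = 0"
| "workload_of E (Bang M) = 0"
| "workload_of E (Lam p M) =
     workload_of E M + (\<Sum>(x, A) \<in> {(x, A) \<in> E p. x \<notin> fv M}. workload_ty A)"
| "workload_of E (App M N) = workload_of E M + workload_of E N"
| "workload_of E Unit = 0"
| "workload_of E (Tensor M N) = workload_of E M + workload_of E N"
| "workload_of E Top = 0"
| "workload_of E (With M N) = workload_of E M + workload_of E N"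
| "workload_of E (Num r) = 0"
| "workload_of E (Fn f) = 1"
| "workload_of E Plus = 1"
| "workload_of E Times = 1"

primrec ground_ty :: "ty \<Rightarrow> bool" where
  "ground_ty TReal = True"
| "ground_ty (Lolli A B) = False"
| "ground_ty TOne = True"
| "ground_ty (TTensor A B) = (ground_ty A \<and> ground_ty B)"
| "ground_ty TTop = True"
| "ground_ty (TWith A B) = (ground_ty A \<and> ground_ty B)"
| "ground_ty (TBang A) = ground_ty A"

definition safe_of :: "(pat \<Rightarrow> (var \<times> ty) set) \<Rightarrow> 'f tm \<Rightarrow> bool" where
  "safe_of E M \<longleftrightarrow>
     (\<forall>M'. Bang M' \<in> subterms M \<longrightarrow> workload_of E M' = 0) \<and>
     (\<forall>M1 M2. With M1 M2 \<in> subterms M \<longrightarrow> (\<forall>x \<in> fv M1 \<inter> fv M2. ground_ty (vty x)))"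

abbreviation workload :: "'f tm \<Rightarrow> nat" where "workload \<equiv> workload_of pat_env"
abbreviation safe :: "'f tm \<Rightarrow> bool" where "safe \<equiv> safe_of pat_env"

abbreviation workload_bare :: "'f tm \<Rightarrow> nat" where "workload_bare \<equiv> workload_of pat_vars"
abbreviation safe_bare :: "'f tm \<Rightarrow> bool" where "safe_bare \<equiv> safe_of pat_vars"


subsection \<open>Abbreviations\<close>

abbreviation Let_in :: "pat \<Rightarrow> 'f tm \<Rightarrow> 'f tm \<Rightarrow> 'f tm" where
  "Let_in p N M \<equiv> App (Lam p M) N"

abbreviation Sec :: "'f tm \<Rightarrow> 'f tm" where "Sec M \<equiv> With Unit M"
abbreviation PSec :: "pat \<Rightarrow> pat" where "PSec p \<equiv> PWith PUnit p"

fun with_ty :: "ty list \<Rightarrow> ty" where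
  "with_ty [] = TTop"
| "with_ty [A] = A"
| "with_ty (A # B # As) = TWith A (with_ty (B # As))"

fun with_tm :: "'f tm list \<Rightarrow> 'f tm" where
  "with_tm [] = Top"
| "with_tm [M] = M"
| "with_tm (M # N # Ms) = With M (with_tm (N # Ms))"

fun tensor_tm :: "'f tm list \<Rightarrow> 'f tm" where
  "tensor_tm [] = Unit"
| "tensor_tm [M] = M"
| "tensor_tm (M # N # Ms) = Tensor M (tensor_tm (N # Ms))"

definition y_top :: var where "y_top = Var (Aux 0) TTop"

fun with_pat :: "pat list \<Rightarrow> pat" where
  "with_pat [] = PVar y_top"
| "with_pat [p] = p"
| "with_pat (p # q # ps) = PWith p (with_pat (q # ps))"

text \<open>The following three are meant for types built from \<open>TReal\<close>, \<open>TTop\<close> and \<open>TWith\<close> only.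
  In \<open>scale_at\<close> the variable \<open>x\<close> must not carry an auxiliary name.\<close>

fun zero_at :: "ty \<Rightarrow> 'f tm" where
  "zero_at TReal = Num 0"
| "zero_at TTop = Top"
| "zero_at (TWith H K) = With (zero_at H) (zero_at K)"

fun plus_at :: "ty \<Rightarrow> 'f tm" where
  "plus_at TReal = Plus"
| "plus_at TTop = Lam (PWith (PVar (Var (Aux 1) TTop)) (PVar (Var (Aux 2) TTop))) Top"
| "plus_at (TWith H K) =
     (let h = Var (Aux 1) H; k = Var (Aux 2) K; h' = Var (Aux 3) H; k' = Var (Aux 4) K
      in Lam (PWith (PWith (PVar h) (PVar k)) (PWith (PVar h') (PVar k')))
           (With (App (plus_at H) (With (V h) (V h'))) (App (plus_at K) (With (V k) (V k')))))"

fun scale_at :: "ty \<Rightarrow> var \<Rightarrow> 'f tm" where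
  "scale_at TReal x = App Times (V x)"
| "scale_at TTop x = Lam (PVar (Var (Aux 1) TTop)) Top"
| "scale_at (TWith H K) x =
     (let h = Var (Aux 1) H; k = Var (Aux 2) K
      in Lam (PWith (PVar h) (PVar k))
           (With (App (scale_at H x) (V h)) (App (scale_at K x) (V k))))"


section \<open>Linear A\<close>

datatype jty = JReal | JOne | JTensor jty jty

datatype pvar = PV nat (pty: jty)
datatype tvar = TV nat (tty: jty)

datatype 'f exp =
    Ret pvar tvar
  | LetE pvar tvar "'f exp" "'f exp"        (* let (x; y) = e1 in e2 *)
  | UnitP
  | UnitT
  | LetUnitP pvar "'f exp"
  | LetUnitT tvar "'f exp"
  | PairT tvar tvar
  | LetPairT tvar tvar tvar "'f exp"        (* let (x1, x2) = z in e *)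
  | ZeroT jty
  | AddT tvar tvar
  | ScaleT pvar tvar
  | NumP real
  | FnP 'f "pvar list"
  | Dup tvar
  | Drop "'f exp"

text \<open>Variables carry their types, so a context is a set of variables.\<close>

inductive typed :: "('f \<Rightarrow> nat) \<Rightarrow> pvar set \<Rightarrow> tvar set \<Rightarrow> 'f exp \<Rightarrow> jty \<Rightarrow> jty \<Rightarrow> bool"
  for ar :: "'f \<Rightarrow> nat"
where
  Ret: "typed ar {x} {y} (Ret x y) (pty x) (tty y)"
| LetE: "\<lbrakk> typed ar \<Gamma>1 \<Delta>1 e1 (pty x) (tty y); typed ar (insert x \<Gamma>2) (insert y \<Delta>2) e2 \<tau> \<sigma>;
    x \<notin> \<Gamma>2; y \<notin> \<Delta>2; \<Delta>1 \<inter> \<Delta>2 = {} \<rbrakk>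
    \<Longrightarrow> typed ar (\<Gamma>1 \<union> \<Gamma>2) (\<Delta>1 \<union> \<Delta>2) (LetE x y e1 e2) \<tau> \<sigma>"
| UnitP: "typed ar {} {} UnitP JOne JOne"
| UnitT: "typed ar {} {} UnitT JOne JOne"
| LetUnitP: "\<lbrakk> typed ar \<Gamma> \<Delta> e \<tau> \<sigma>; pty z = JOne; z \<notin> \<Gamma> \<rbrakk>
    \<Longrightarrow> typed ar (insert z \<Gamma>) \<Delta> (LetUnitP z e) \<tau> \<sigma>"
| LetUnitT: "\<lbrakk> typed ar \<Gamma> \<Delta> e \<tau> \<sigma>; tty z = JOne; z \<notin> \<Delta> \<rbrakk>
    \<Longrightarrow> typed ar \<Gamma> (insert z \<Delta>) (LetUnitT z e) \<tau> \<sigma>"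
| PairT: "x1 \<noteq> x2 \<Longrightarrow> typed ar {} {x1, x2} (PairT x1 x2) JOne (JTensor (tty x1) (tty x2))"
| LetPairT: "\<lbrakk> typed ar \<Gamma> (insert x1 (insert x2 \<Delta>)) e \<tau> \<sigma>; x1 \<noteq> x2; x1 \<notin> \<Delta>; x2 \<notin> \<Delta>;
    tty z = JTensor (tty x1) (tty x2); z \<notin> \<Delta> \<rbrakk>
    \<Longrightarrow> typed ar \<Gamma> (insert z \<Delta>) (LetPairT x1 x2 z e) \<tau> \<sigma>"
| ZeroT: "typed ar {} {} (ZeroT \<tau>) JOne \<tau>"
| AddT: "\<lbrakk> x \<noteq> y; tty x = \<tau>; tty y = \<tau> \<rbrakk> \<Longrightarrow> typed ar {} {x, y} (AddT x y) JOne \<tau>"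
| ScaleT: "pty x = JReal \<Longrightarrow> typed ar {x} {y} (ScaleT x y) JOne (tty y)"
| NumP: "typed ar {} {} (NumP r) JReal JOne"
| FnP: "\<lbrakk> length xs = ar f; distinct xs; \<forall>x \<in> set xs. pty x = JReal \<rbrakk>
    \<Longrightarrow> typed ar (set xs) {} (FnP f xs) JReal JOne"
| Dup: "typed ar {} {x} (Dup x) JOne (JTensor (tty x) (tty x))"
| Drop: "typed ar \<Gamma> \<Delta> e \<tau> \<sigma> \<Longrightarrow> typed ar \<Gamma> \<Delta> (Drop e) JOne JOne"

primrec fvt :: "'f exp \<Rightarrow> tvar set" where
  "fvt (Ret x y) = {y}"
| "fvt (LetE x y e1 e2) = fvt e1 \<union> (fvt e2 - {y})"
| "fvt UnitP = {}"
| "fvt UnitT = {}"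
| "fvt (LetUnitP z e) = fvt e"
| "fvt (LetUnitT z e) = insert z (fvt e)"
| "fvt (PairT x1 x2) = {x1, x2}"
| "fvt (LetPairT x1 x2 z e) = insert z (fvt e - {x1, x2})"
| "fvt (ZeroT \<tau>) = {}"
| "fvt (AddT x y) = {x, y}"
| "fvt (ScaleT x y) = {y}"
| "fvt (NumP r) = {}"
| "fvt (FnP f xs) = {}"
| "fvt (Dup y) = {y}"
| "fvt (Drop e) = fvt e"

text \<open>The primal and the tangent type of an expression, computed from the types of its variables.\<close>

primrec exp_ty :: "'f exp \<Rightarrow> jty \<times> jty" where
  "exp_ty (Ret x y) = (pty x, tty y)"
| "exp_ty (LetE x y e1 e2) = exp_ty e2"
| "exp_ty UnitP = (JOne, JOne)"
| "exp_ty UnitT = (JOne, JOne)"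
| "exp_ty (LetUnitP z e) = exp_ty e"
| "exp_ty (LetUnitT z e) = exp_ty e"
| "exp_ty (PairT x1 x2) = (JOne, JTensor (tty x1) (tty x2))"
| "exp_ty (LetPairT x1 x2 z e) = exp_ty e"
| "exp_ty (ZeroT \<tau>) = (JOne, \<tau>)"
| "exp_ty (AddT x y) = (JOne, tty y)"
| "exp_ty (ScaleT x y) = (JOne, tty y)"
| "exp_ty (NumP r) = (JReal, JOne)"
| "exp_ty (FnP f xs) = (JReal, JOne)"
| "exp_ty (Dup y) = (JOne, JTensor (tty y) (tty y))"
| "exp_ty (Drop e) = (JOne, JOne)"

lemma typed_exp_ty: "typed ar \<Gamma> \<Delta> e \<tau> \<sigma> \<Longrightarrow> exp_ty e = (\<tau>, \<sigma>)"
  by (induction rule: typed.induct) auto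

lemma typed_fvt: "typed ar \<Gamma> \<Delta> e \<tau> \<sigma> \<Longrightarrow> fvt e = \<Delta>"
  by (induction rule: typed.induct) auto

primrec jax_workload_ty :: "jty \<Rightarrow> nat" where
  "jax_workload_ty JReal = 1"
| "jax_workload_ty JOne = 0"
| "jax_workload_ty (JTensor \<tau> \<sigma>) = jax_workload_ty \<tau> + jax_workload_ty \<sigma>"

primrec jax_workload :: "'f exp \<Rightarrow> nat" where
  "jax_workload (Ret x y) = 0"
| "jax_workload (LetE x y e1 e2) = jax_workload e1 + jax_workload e2"
| "jax_workload UnitP = 0"
| "jax_workload UnitT = 0"
| "jax_workload (LetUnitP z e) = jax_workload e"
| "jax_workload (LetUnitT z e) = jax_workload e"
| "jax_workload (PairT x1 x2) = 0"
| "jax_workload (LetPairT x1 x2 z e) = jax_workload e"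
| "jax_workload (ZeroT \<tau>) = 1 + jax_workload_ty \<tau>"
| "jax_workload (AddT x y) = jax_workload_ty (tty y)"
| "jax_workload (ScaleT x y) = jax_workload_ty (tty y)"
| "jax_workload (NumP r) = 1"
| "jax_workload (FnP f xs) = 1"
| "jax_workload (Dup y) = 0"
| "jax_workload (Drop e) =
     jax_workload e + jax_workload_ty (fst (exp_ty e)) + jax_workload_ty (snd (exp_ty e))"

text \<open>If \<open>y : \<tau>\<close> and \<open>\<tau>\<close> has no occurrence of the type of reals, then the translation of the scaling
  of \<open>y\<close> by \<open>x\<close> does not mention \<open>x\<close>. With \<open>workload_bare\<close>, erasing such an \<open>x\<close> would cost 1,
  whereas the scaling itself has Linear A workload 0.\<close>

primrec proper_scalings :: "'f exp \<Rightarrow> bool" where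
  "proper_scalings (Ret x y) = True"
| "proper_scalings (LetE x y e1 e2) = (proper_scalings e1 \<and> proper_scalings e2)"
| "proper_scalings UnitP = True"
| "proper_scalings UnitT = True"
| "proper_scalings (LetUnitP z e) = proper_scalings e"
| "proper_scalings (LetUnitT z e) = proper_scalings e"
| "proper_scalings (PairT x1 x2) = True"
| "proper_scalings (LetPairT x1 x2 z e) = proper_scalings e"
| "proper_scalings (ZeroT \<tau>) = True"
| "proper_scalings (AddT x y) = True"
| "proper_scalings (ScaleT x y) = (1 \<le> jax_workload_ty (tty y))"
| "proper_scalings (NumP r) = True"
| "proper_scalings (FnP f xs) = True"
| "proper_scalings (Dup y) = True"
| "proper_scalings (Drop e) = proper_scalings e"


section \<open>The translation\<close>

primrec tr_p :: "jty \<Rightarrow> ty" where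
  "tr_p JReal = TReal"
| "tr_p JOne = TOne"
| "tr_p (JTensor \<tau> \<sigma>) = TTensor (TBang (tr_p \<tau>)) (TBang (tr_p \<sigma>))"

primrec tr_t :: "jty \<Rightarrow> ty" where
  "tr_t JReal = TReal"
| "tr_t JOne = TTop"
| "tr_t (JTensor \<tau> \<sigma>) = TWith (tr_t \<tau>) (tr_t \<sigma>)"

fun pv :: "pvar \<Rightarrow> var" where
  "pv (PV n \<tau>) = Var (Primal n) (tr_p \<tau>)"

fun uv :: "tvar \<Rightarrow> var" where
  "uv (TV n \<sigma>) = Var (Tangent n) (tr_t \<sigma>)"

abbreviation u_tm :: "tvar list \<Rightarrow> 'f tm" where
  "u_tm \<theta> \<equiv> with_tm (map (\<lambda>w. V (uv w)) \<theta>)"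

abbreviation u_pat :: "tvar list \<Rightarrow> pat" where
  "u_pat \<theta> \<equiv> with_pat (map (\<lambda>w. PVar (uv w)) \<theta>)"

abbreviation u_ty :: "tvar list \<Rightarrow> ty" where
  "u_ty \<theta> \<equiv> with_ty (map (\<lambda>w. tr_t (tty w)) \<theta>)"

text \<open>The auxiliary names \<open>f\<close>, \<open>g\<close>, \<open>z\<close> are used for the components of the translations of
  subexpressions; different bound variables that are in scope together have different names. In the
  clause for \<open>LetE\<close> the list \<open>\<theta>2\<close> leaves out the variable bound by the let, which is not in
  \<open>\<theta>\<close> anyway unless the let reuses the name of a free variable of \<open>e1\<close>.\<close>

primrec delta :: "'f exp \<Rightarrow> tvar list \<Rightarrow> 'f tm" where
  "delta (Ret x y) \<theta> = Tensor (Bang (V (pv x))) (Sec (Lam (u_pat \<theta>) (V (uv y))))"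
| "delta (LetE x y e1 e2) \<theta> =
     (let \<theta>1 = filter (\<lambda>w. w \<in> fvt e1) \<theta>;
          \<theta>2 = filter (\<lambda>w. w \<in> fvt e2 - {y}) \<theta>;
          f = Var (Aux 5) (Lolli (u_ty \<theta>1) (tr_t (snd (exp_ty e1))));
          g = Var (Aux 6) (Lolli (u_ty (y # \<theta>2)) (tr_t (snd (exp_ty e2))));
          z = Var (Aux 7) (tr_p (fst (exp_ty e2)))
      in Let_in (PTensor (PBang (pv x)) (PSec (PVar f))) (delta e1 \<theta>1)
           (Let_in (PTensor (PBang z) (PSec (PVar g))) (delta e2 (y # \<theta>2))
             (Tensor (Bang (V z))
               (Sec (Lam (u_pat \<theta>)
                 (App (V g)
                   (with_tm (App (V f) (u_tm \<theta>1) # map (\<lambda>w. V (uv w)) \<theta>2))))))))"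
| "delta UnitP \<theta> = Tensor (Bang Unit) (Sec (Lam (PVar y_top) Top))"
| "delta UnitT \<theta> = Tensor (Bang Unit) (Sec (Lam (PVar y_top) Top))"
| "delta (LetUnitP z e) \<theta> = Let_in PUnit (V (pv z)) (delta e \<theta>)"
| "delta (LetUnitT z e) \<theta> =
     (let \<theta>' = removeAll z \<theta>;
          f = Var (Aux 5) (Lolli (u_ty \<theta>') (tr_t (snd (exp_ty e))));
          x = Var (Aux 7) (tr_p (fst (exp_ty e)))
      in Let_in (PTensor (PBang x) (PSec (PVar f))) (delta e \<theta>')
           (Tensor (Bang (V x)) (Sec (Lam (u_pat \<theta>) (App (V f) (u_tm \<theta>'))))))"
| "delta (PairT x1 x2) \<theta> =
     Tensor (Bang Unit) (Sec (Lam (u_pat \<theta>) (With (V (uv x1)) (V (uv x2)))))"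
| "delta (LetPairT x1 x2 z e) \<theta> =
     (let \<theta>' = removeAll z \<theta>;
          f = Var (Aux 5) (Lolli (u_ty (x1 # x2 # \<theta>')) (tr_t (snd (exp_ty e))));
          x = Var (Aux 7) (tr_p (fst (exp_ty e)));
          v1 = Var (Aux 1) (tr_t (tty x1));
          v2 = Var (Aux 2) (tr_t (tty x2));
          p = with_pat
                (map (\<lambda>w. if w = z then PWith (PVar v1) (PVar v2) else PVar (uv w)) \<theta>)
      in Let_in (PTensor (PBang x) (PSec (PVar f))) (delta e (x1 # x2 # \<theta>'))
           (Tensor (Bang (V x))
             (Sec (Lam p
               (App (V f) (with_tm (V v1 # V v2 # map (\<lambda>w. V (uv w)) \<theta>')))))))"
| "delta (ZeroT \<sigma>) \<theta> = Tensor (Bang Unit) (Sec (Lam (PVar y_top) (zero_at (tr_t \<sigma>))))"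
| "delta (AddT y1 y2) \<theta> =
     Tensor (Bang Unit)
       (Sec (Lam (u_pat \<theta>) (App (plus_at (tr_t (tty y2))) (With (V (uv y1)) (V (uv y2))))))"
| "delta (ScaleT x y) \<theta> =
     Tensor (Bang Unit)
       (Sec (Lam (u_pat \<theta>) (App (scale_at (tr_t (tty y)) (pv x)) (V (uv y)))))"
| "delta (NumP r) \<theta> = Tensor (Bang (Num r)) (Sec (Lam (PVar y_top) Top))"
| "delta (FnP f xs) \<theta> =
     Tensor (App (Fn f) (tensor_tm (map (\<lambda>x. Bang (V (pv x))) xs)))
       (Sec (Lam (PVar y_top) Top))"
| "delta (Dup y) \<theta> =
     Tensor (Bang Unit) (Sec (Lam (u_pat \<theta>) (With (V (uv y)) (V (uv y)))))"
| "delta (Drop e) \<theta> =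
     (let f = Var (Aux 5) (Lolli (u_ty \<theta>) (tr_t (snd (exp_ty e))));
          x = Var (Aux 7) (tr_p (fst (exp_ty e)));
          y = Var (Aux 8) (u_ty \<theta>);
          z = Var (Aux 9) (tr_t (snd (exp_ty e)))
      in Let_in (PTensor (PBang x) (PSec (PVar f))) (delta e \<theta>)
           (Tensor (Bang Unit)
             (Sec (Lam (PVar y) (Let_in (PVar z) (App (V f) (V y)) Top)))))"

end

theory Submission
  imports Defs
begin

text \<open>Both bounds are proved by one induction on the typing derivation, for every enumeration of the
  tangent context. Every abstraction built by the translation uses the variables it binds, with
  three exceptions: variables whose type has no workload, the two results discarded by \<open>Drop\<close>, which
  \<open>Drop\<close> pays for, and the primal variable \<open>x\<close> of \<open>LetE\<close>. The last is free under the reading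
  \<open>pat_env\<close>; under \<open>pat_vars\<close> it does occur, because Linear A uses every primal variable
  of the context and only a scaling at a type without reals loses it. Safety needs no typing:
  the components of a tuple share only variables of translated types, which are ground.\<close>

section \<open>Workload and safety of compound terms\<close>

lemma fvp_with_pat: "fvp (with_pat ps) = (if ps = [] then {y_top} else (\<Union>p \<in> set ps. fvp p))"
  by (induction ps rule: with_pat.induct) auto

lemma fv_with_tm: "fv (with_tm Ms) = (\<Union>M \<in> set Ms. fv M)"
  by (induction Ms rule: with_tm.induct) auto

lemma fv_tensor_tm: "fv (tensor_tm Ms) = (\<Union>M \<in> set Ms. fv M)"
  by (induction Ms rule: tensor_tm.induct) auto

lemma workload_with_tm: "workload_of E (with_tm Ms) = (\<Sum>M \<leftarrow> Ms. workload_of E M)"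
  by (induction Ms rule: with_tm.induct) auto

lemma workload_tensor_tm: "workload_of E (tensor_tm Ms) = (\<Sum>M \<leftarrow> Ms. workload_of E M)"
  by (induction Ms rule: tensor_tm.induct) auto

text \<open>Trades the quantification over all subterms for a condition on the outermost
  constructor, so that safety can be proved by structural induction.\<close>

lemma safe_of_simps [simp]:
  "safe_of E (V x)"
  "safe_of E (Bang M) \<longleftrightarrow> safe_of E M \<and> workload_of E M = 0"
  "safe_of E (Lam p M) \<longleftrightarrow> safe_of E M"
  "safe_of E (App M N) \<longleftrightarrow> safe_of E M \<and> safe_of E N"
  "safe_of E Unit"
  "safe_of E (Tensor M N) \<longleftrightarrow> safe_of E M \<and> safe_of E N"
  "safe_of E Top"
  "safe_of E (With M N) \<longleftrightarrow>
     safe_of E M \<and> safe_of E N \<and> (\<forall>x \<in> fv M \<inter> fv N. ground_ty (vty x))"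
  "safe_of E (Num r)"
  "safe_of E (Fn f)"
  "safe_of E Plus"
  "safe_of E Times"
  by (auto simp: safe_of_def)

lemma safe_tensor_tm: "(\<And>M. M \<in> set Ms \<Longrightarrow> safe_of E M) \<Longrightarrow> safe_of E (tensor_tm Ms)"
  by (induction Ms rule: tensor_tm.induct) auto

text \<open>Tuples are right-nested, so a variable shared by the two sides of a pair lies in a
  component after the first. The first one is exempt from groundness: for \<open>LetE\<close> it
  contains the function variable \<open>f\<close>.\<close>

lemma safe_with_tm:
  "\<lbrakk>\<And>M. M \<in> set Ms \<Longrightarrow> safe_of E M; \<And>M x. M \<in> set (tl Ms) \<Longrightarrow> x \<in> fv M \<Longrightarrow> ground_ty (vty x)\<rbrakk>
    \<Longrightarrow> safe_of E (with_tm Ms)"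
proof (induction Ms rule: with_tm.induct)
  case (3 M N Ms)
  have "safe_of E (with_tm (N # Ms))"
    using 3 by auto
  then show ?case
    using 3 by (fastforce simp: fv_with_tm)
qed auto

text \<open>Under either reading a pattern entry has type \<open>vty x\<close> or
  \<open>TBang (vty x)\<close>, and the latter has workload 0.\<close>

lemma workload_Lam_used:
  assumes "E = pat_env \<or> E = pat_vars"
    and "\<forall>x \<in> fvp p. x \<in> fv M \<or> workload_ty (vty x) = 0"
  shows "workload_of E (Lam p M) = workload_of E M"
proof -
  have "x \<in> fvp p \<and> (A = vty x \<or> A = TBang (vty x))" if "(x, A) \<in> pat_env p" for x A
    using that by (induction p) auto
  then have "workload_ty A = 0" if "(x, A) \<in> E p" "x \<notin> fv M" for x A
    using assms that by (fastforce simp: pat_vars_def)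
  then show ?thesis
    by (auto intro!: sum.neutral)
qed

lemma workload_Lam_PVar_unused:
  "E = pat_env \<or> E = pat_vars \<Longrightarrow> x \<notin> fv M \<Longrightarrow>
    workload_of E (Lam (PVar x) M) = workload_of E M + workload_ty (vty x)"
proof -
  assume "E = pat_env \<or> E = pat_vars" "x \<notin> fv M"
  then have "{(x', A) \<in> E (PVar x). x' \<notin> fv M} = {(x, vty x)}"
    by (auto simp: pat_vars_def)
  then show ?thesis
    by simp
qed

abbreviation result_pat :: "var \<Rightarrow> var \<Rightarrow> pat" where
  "result_pat x f \<equiv> PTensor (PBang x) (PSec (PVar f))"

lemma workload_Lam_result_pat_env:
  assumes "f \<in> fv M"
  shows "workload (Lam (result_pat x f) M) = workload M"
proof -
  have "workload_ty A = 0" if "(x', A) \<in> pat_env (result_pat x f)" "x' \<notin> fv M" for x' A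
    using assms that by auto
  then show ?thesis
    by (auto intro!: sum.neutral simp del: pat_env.simps)
qed

text \<open>Serves \<open>Drop\<close>, which discards \<open>x\<close>: this is free with
  \<open>pat_env\<close> and costs at most the workload of its type with
  \<open>pat_vars\<close>.\<close>

lemma workload_Lam_result_pat_le:
  assumes "E = pat_env \<or> E = pat_vars" and "f \<in> fv M"
  shows "workload_of E (Lam (result_pat x f) M) \<le> workload_of E M + workload_ty (vty x)"
proof (cases "E = pat_env")
  case True
  then show ?thesis
    using workload_Lam_result_pat_env[OF assms(2)] by simp
next
  case False
  have "{(x', A) \<in> pat_vars (result_pat x f). x' \<notin> fv M} \<subseteq> {(x, vty x)}"
    using assms by (auto simp: pat_vars_def)
  then have "(\<Sum>(x, A) \<in> {(x', A) \<in> pat_vars (result_pat x f). x' \<notin> fv M}. workload_ty A)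
      \<le> (\<Sum>(x, A) \<in> {(x, vty x)}. workload_ty A)"
    by (intro sum_mono2) auto
  then show ?thesis
    using False assms(1) by simp
qed

declare workload_of.simps(3) [simp del]


section \<open>Translated types and the arithmetic at them\<close>

lemma ground_tr_t [simp]: "ground_ty (tr_t \<tau>)"
  by (induction \<tau>) auto

lemma ground_tr_p [simp]: "ground_ty (tr_p \<tau>)"
  by (induction \<tau>) auto

lemma workload_tr_t [simp]: "workload_ty (tr_t \<tau>) = jax_workload_ty \<tau>"
  by (induction \<tau>) auto

text \<open>Only an inequality, unlike for \<open>tr_t\<close>: the components of a translated
  tensor stand under a bang and count for nothing.\<close>

lemma workload_tr_p_le: "workload_ty (tr_p \<tau>) \<le> jax_workload_ty \<tau>"
  by (cases \<tau>) auto

lemma tr_p_inject [simp]: "tr_p \<tau> = tr_p \<tau>' \<longleftrightarrow> \<tau> = \<tau>'"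
proof (induction \<tau> arbitrary: \<tau>')
  case JReal then show ?case by (cases \<tau>') auto
next
  case JOne then show ?case by (cases \<tau>') auto
next
  case (JTensor \<tau>1 \<tau>2) then show ?case by (cases \<tau>') auto
qed

lemma pv_inject [simp]: "pv x = pv x' \<longleftrightarrow> x = x'"
  by (cases x; cases x') auto

lemma vty_pv [simp]: "vty (pv x) = tr_p (pty x)"
  by (cases x) auto

lemma vty_uv [simp]: "vty (uv y) = tr_t (tty y)"
  by (cases y) auto

text \<open>The disjoint supplies of names replace freshness conditions when free variables are
  computed.\<close>

lemma pv_distinct [simp]:
  "pv x \<noteq> uv y" "uv y \<noteq> pv x" "pv x \<noteq> y_top" "pv x \<noteq> Var (Aux n) A" "Var (Aux n) A \<noteq> pv x"
  by (cases x; cases y; simp add: y_top_def)+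

lemma uv_distinct [simp]: "uv y \<noteq> Var (Aux n) A" "Var (Aux n) A \<noteq> uv y"
  by (cases y; simp)+

lemma y_top_distinct [simp]: "Var (Aux n) A = y_top \<longleftrightarrow> n = 0 \<and> A = TTop"
  by (auto simp: y_top_def)

lemma vty_y_top [simp]: "vty y_top = TTop"
  by (simp add: y_top_def)

lemma fv_zero_at [simp]: "fv (zero_at (tr_t \<tau>)) = {}"
  by (induction \<tau>) auto

lemma safe_zero_at [simp]: "safe_of E (zero_at (tr_t \<tau>))"
  by (induction \<tau>) auto

lemma workload_zero_at [simp]: "workload_of E (zero_at (tr_t \<tau>)) = 0"
  by (induction \<tau>) auto

lemma fv_plus_at [simp]: "fv (plus_at (tr_t \<tau>)) = {}"
  by (induction \<tau>) (auto simp: Let_def)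

lemma safe_plus_at [simp]: "safe_of E (plus_at (tr_t \<tau>))"
  by (induction \<tau>) (auto simp: Let_def)

lemma workload_plus_at:
  assumes "E = pat_env \<or> E = pat_vars"
  shows "workload_of E (plus_at (tr_t \<tau>)) = jax_workload_ty \<tau>"
  by (induction \<tau>) (auto simp: Let_def workload_Lam_used[OF assms])

text \<open>The variable survives only where \<open>Times\<close> is applied to it, that is, at a
  component \<open>TReal\<close>; hence the condition in \<open>proper_scalings\<close>.\<close>

lemma fv_scale_at:
  "fv (scale_at (tr_t \<tau>) (pv x)) = (if 1 \<le> jax_workload_ty \<tau> then {pv x} else {})"
  by (induction \<tau>) (auto simp: Let_def)

lemma safe_scale_at [simp]: "safe_of E (scale_at (tr_t \<tau>) (pv x))"
  by (induction \<tau>) (auto simp: Let_def fv_scale_at split: if_splits)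

lemma workload_scale_at:
  assumes "E = pat_env \<or> E = pat_vars"
  shows "workload_of E (scale_at (tr_t \<tau>) (pv x)) = jax_workload_ty \<tau>"
  by (induction \<tau>) (auto simp: Let_def workload_Lam_used[OF assms])


section \<open>The translation\<close>

lemma safe_u_tm [simp]: "safe_of E (u_tm \<theta>)"
  by (rule safe_with_tm) (auto simp: map_tl[symmetric])

text \<open>Every bang encloses a variable, \<open>Unit\<close> or a numeral. One side of each
  \<open>Sec\<close> is closed, and the variables shared within other pairs have translated
  types.\<close>

lemma safe_delta: "safe_of E (delta e \<theta>)"
  by (induction e arbitrary: \<theta>)
    (auto simp: Let_def fv_scale_at split: if_splits intro!: safe_with_tm safe_tensor_tm)

text \<open>Makes the \<open>x\<close> bound by \<open>LetE\<close> occur in the translation of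
  \<open>e2\<close>, as \<open>pat_vars\<close> requires. Each typing rule adds to the context only
  primal variables that the expression mentions.\<close>

lemma primal_vars_used:
  assumes "typed ar \<Gamma> \<Delta> e \<tau> \<sigma>" and "proper_scalings e"
  shows "pv ` \<Gamma> \<subseteq> fv (delta e \<theta>)"
  using assms
proof (induction arbitrary: \<theta> rule: typed.induct)
  case (LetE \<Gamma>1 \<Delta>1 e1 x y \<Gamma>2 \<Delta>2 e2 \<tau> \<sigma>)
  then have "pv ` \<Gamma>1 \<subseteq> fv (delta e1 \<theta>')" and "pv ` insert x \<Gamma>2 \<subseteq> fv (delta e2 \<theta>')" for \<theta>'
    by auto
  \<comment> \<open>The outer pattern binds \<open>pv x\<close>; as \<open>pv\<close> is injective,
    this hides no variable of \<open>\<Gamma>2\<close>.\<close>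
  with \<open>x \<notin> \<Gamma>2\<close> show ?case
    by (fastforce simp: Let_def)
qed (auto simp: Let_def fv_scale_at fvp_with_pat fv_tensor_tm)

text \<open>The disjunction lets one induction serve both readings. \<open>\<theta>\<close> is
  generalized because subexpressions are translated with other lists.\<close>

lemma workload_delta_le:
  assumes "typed ar \<Gamma> \<Delta> e \<tau> \<sigma>" and "set \<theta> = \<Delta>"
    and "E = pat_env \<or> E = pat_vars \<and> proper_scalings e"
  shows "workload_of E (delta e \<theta>) \<le> jax_workload e"
  using assms
proof (induction arbitrary: \<theta> rule: typed.induct)
  case (LetE \<Gamma>1 \<Delta>1 e1 x y \<Gamma>2 \<Delta>2 e2 \<tau> \<sigma>)
  have E: "E = pat_env \<or> E = pat_vars"
    using LetE.prems by auto
  define \<theta>1 where "\<theta>1 = filter (\<lambda>w. w \<in> fvt e1) \<theta>"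
  define \<theta>2 where "\<theta>2 = filter (\<lambda>w. w \<in> fvt e2 - {y}) \<theta>"
  have fvt: "fvt e1 = \<Delta>1" "fvt e2 = insert y \<Delta>2"
    using LetE.hyps typed_fvt by blast+
  have set1: "set \<theta>1 = \<Delta>1" and set2: "set (y # \<theta>2) = insert y \<Delta>2"
    using LetE.prems by (auto simp: \<theta>1_def \<theta>2_def fvt)
  \<comment> \<open>If the let reuses the name of a variable of \<open>\<Delta>1\<close>, then
    \<open>y\<close> is in \<open>\<theta>\<close>, and it is \<open>\<theta>1\<close> that contains
    it.\<close>
  have covers: "set \<theta> \<subseteq> set \<theta>1 \<union> set \<theta>2"
    using LetE.prems \<open>y \<notin> \<Delta>2\<close> by (auto simp: \<theta>1_def \<theta>2_def fvt)
  define f where "f = Var (Aux 5) (Lolli (u_ty \<theta>1) (tr_t (snd (exp_ty e1))))"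
  define g where "g = Var (Aux 6) (Lolli (u_ty (y # \<theta>2)) (tr_t (snd (exp_ty e2))))"
  define z where "z = Var (Aux 7) (tr_p (fst (exp_ty e2)))"
  define B :: "'a tm" where
    "B = App (V g) (with_tm (App (V f) (u_tm \<theta>1) # map (\<lambda>w. V (uv w)) \<theta>2))"
  define R :: "'a tm" where "R = Tensor (Bang (V z)) (Sec (Lam (u_pat \<theta>) B))"
  define N where "N = Let_in (result_pat z g) (delta e2 (y # \<theta>2)) R"
  have delta: "delta (LetE x y e1 e2) \<theta> = Let_in (result_pat (pv x) f) (delta e1 \<theta>1) N"
    by (simp add: Let_def N_def R_def B_def f_def g_def z_def \<theta>1_def \<theta>2_def)
  have fvB: "fv B = {f, g} \<union> uv ` (set \<theta>1 \<union> set \<theta>2)"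
    by (auto simp: B_def fv_with_tm)
  have "workload_of E (Lam (u_pat \<theta>) B) = workload_of E B"
    using covers by (intro workload_Lam_used[OF E]) (auto simp: fvB fvp_with_pat split: if_splits)
  also have "\<dots> = 0"
    by (simp add: B_def workload_with_tm comp_def)
  finally have R: "workload_of E R = 0"
    by (simp add: R_def)
  have fvR: "z \<in> fv R" "g \<in> fv R" "f \<in> fv R"
    by (auto simp: R_def fvB fvp_with_pat f_def g_def z_def)
  then have "workload_of E (Lam (result_pat z g) R) = 0"
    using R by (simp add: workload_Lam_used[OF E])
  then have N: "workload_of E N \<le> jax_workload e2"
    using LetE.IH(2)[OF set2] LetE.prems by (auto simp: N_def)
  have f: "f \<in> fv N"
    using fvR by (auto simp: N_def f_def g_def z_def)
  \<comment> \<open>Here the readings diverge: with \<open>pat_env\<close> the banged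
    \<open>pv x\<close> may be erased for free, with \<open>pat_vars\<close> it has to occur in
    \<open>N\<close>.\<close>
  have "workload_of E (Lam (result_pat (pv x) f) N) = workload_of E N"
  proof (cases "E = pat_env")
    case True
    then show ?thesis
      using workload_Lam_result_pat_env[OF f] by simp
  next
    case False
    then have "pv x \<in> fv N"
      using primal_vars_used[OF LetE.hyps(2)] LetE.prems by (auto simp: N_def)
    with f show ?thesis
      by (intro workload_Lam_used[OF E]) auto
  qed
  then show ?case
    using N LetE.IH(1)[OF set1] LetE.prems(2) unfolding delta by auto
next
  case (LetUnitP \<Gamma> \<Delta> e \<tau> \<sigma> z)
  then have "workload_of E (Lam PUnit (delta e \<theta>)) = workload_of E (delta e \<theta>)"
    by (intro workload_Lam_used) auto
  then show ?case
    using LetUnitP by simp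
next
  case (LetUnitT \<Gamma> \<Delta> e \<tau> \<sigma> z)
  have E: "E = pat_env \<or> E = pat_vars"
    using LetUnitT.prems by auto
  define f where "f = Var (Aux 5) (Lolli (u_ty (removeAll z \<theta>)) (tr_t (snd (exp_ty e))))"
  define x where "x = Var (Aux 7) (tr_p (fst (exp_ty e)))"
  define B :: "'a tm" where "B = App (V f) (u_tm (removeAll z \<theta>))"
  define R :: "'a tm" where "R = Tensor (Bang (V x)) (Sec (Lam (u_pat \<theta>) B))"
  have delta: "delta (LetUnitT z e) \<theta> = Let_in (result_pat x f) (delta e (removeAll z \<theta>)) R"
    by (simp add: Let_def R_def B_def f_def x_def)
  \<comment> \<open>\<open>uv z\<close> is bound but not passed on to \<open>f\<close>; its type is
    \<open>TTop\<close>, which has workload 0.\<close>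
  have "workload_of E (Lam (u_pat \<theta>) B) = workload_of E B"
    using \<open>tty z = JOne\<close>
    by (intro workload_Lam_used[OF E]) (auto simp: B_def fv_with_tm fvp_with_pat split: if_splits)
  then have "workload_of E R = 0"
    by (simp add: R_def B_def workload_with_tm comp_def)
  moreover have "x \<in> fv R" "f \<in> fv R"
    by (auto simp: R_def B_def fvp_with_pat f_def x_def)
  ultimately have "workload_of E (Lam (result_pat x f) R) = 0"
    by (simp add: workload_Lam_used[OF E])
  moreover have "workload_of E (delta e (removeAll z \<theta>)) \<le> jax_workload e"
    using LetUnitT by auto
  ultimately show ?case
    unfolding delta by simp
next
  case (LetPairT \<Gamma> x1 x2 \<Delta> e \<tau> \<sigma> z)
  have E: "E = pat_env \<or> E = pat_vars"
    using LetPairT.prems by auto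
  define \<theta>' where "\<theta>' = removeAll z \<theta>"
  define f where "f = Var (Aux 5) (Lolli (u_ty (x1 # x2 # \<theta>')) (tr_t (snd (exp_ty e))))"
  define x where "x = Var (Aux 7) (tr_p (fst (exp_ty e)))"
  define v1 where "v1 = Var (Aux 1) (tr_t (tty x1))"
  define v2 where "v2 = Var (Aux 2) (tr_t (tty x2))"
  define p where
    "p = with_pat (map (\<lambda>w. if w = z then PWith (PVar v1) (PVar v2) else PVar (uv w)) \<theta>)"
  define B :: "'a tm" where
    "B = App (V f) (with_tm (V v1 # V v2 # map (\<lambda>w. V (uv w)) \<theta>'))"
  define R :: "'a tm" where "R = Tensor (Bang (V x)) (Sec (Lam p B))"
  have delta: "delta (LetPairT x1 x2 z e) \<theta>
      = Let_in (result_pat x f) (delta e (x1 # x2 # \<theta>')) R"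
    by (simp add: Let_def R_def B_def p_def f_def x_def v1_def v2_def \<theta>'_def cong: if_cong)
  \<comment> \<open>The slot of \<open>z\<close> contributes \<open>v1\<close> and
    \<open>v2\<close>; \<open>y_top\<close> is the default for an empty list and has workload
    0.\<close>
  have fvp: "fvp p \<subseteq> {y_top, v1, v2} \<union> uv ` set \<theta>'"
    by (auto simp: p_def fvp_with_pat \<theta>'_def split: if_splits)
  have fvB: "fv B = {f, v1, v2} \<union> uv ` set \<theta>'"
    by (auto simp: B_def fv_with_tm)
  have "workload_of E (Lam p B) = workload_of E B"
    using fvp by (intro workload_Lam_used[OF E]) (auto simp: fvB)
  then have "workload_of E R = 0"
    by (simp add: R_def B_def workload_with_tm comp_def)
  moreover have "f \<notin> fvp p"
    using fvp by (auto simp: f_def v1_def v2_def)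
  then have "x \<in> fv R" "f \<in> fv R"
    by (simp_all add: R_def fvB)
  ultimately have "workload_of E (Lam (result_pat x f) R) = 0"
    by (simp add: workload_Lam_used[OF E])
  moreover have "workload_of E (delta e (x1 # x2 # \<theta>')) \<le> jax_workload e"
    using LetPairT by (auto simp: \<theta>'_def)
  ultimately show ?case
    unfolding delta by simp
next
  case (Drop \<Gamma> \<Delta> e \<tau> \<sigma>)
  have E: "E = pat_env \<or> E = pat_vars"
    using Drop.prems by auto
  define f where "f = Var (Aux 5) (Lolli (u_ty \<theta>) (tr_t (snd (exp_ty e))))"
  define x where "x = Var (Aux 7) (tr_p (fst (exp_ty e)))"
  define y where "y = Var (Aux 8) (u_ty \<theta>)"
  define z where "z = Var (Aux 9) (tr_t (snd (exp_ty e)))"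
  define R :: "'a tm" where
    "R = Tensor (Bang Unit) (Sec (Lam (PVar y) (Let_in (PVar z) (App (V f) (V y)) Top)))"
  have delta: "delta (Drop e) \<theta> = Let_in (result_pat x f) (delta e \<theta>) R"
    by (simp add: Let_def R_def f_def x_def y_def z_def)
  \<comment> \<open>The discarded \<open>z\<close> accounts for the tangent part of the surcharge of
    \<open>Drop\<close>; the discarded \<open>x\<close> below is covered by the primal part.\<close>
  have "workload_of E R = jax_workload_ty (snd (exp_ty e))"
    by (simp add: R_def workload_Lam_used[OF E] workload_Lam_PVar_unused[OF E] z_def)
  moreover have "f \<in> fv R"
    by (simp add: R_def f_def y_def)
  then have "workload_of E (Lam (result_pat x f) R)
      \<le> workload_of E R + workload_ty (tr_p (fst (exp_ty e)))"
    using workload_Lam_result_pat_le[OF E, of f R x] by (simp add: x_def)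
  moreover have "workload_of E (delta e \<theta>) \<le> jax_workload e"
    using Drop by simp
  ultimately show ?case
    using workload_tr_p_le[of "fst (exp_ty e)"] unfolding delta by simp
next
  case (Ret x y)
  then have E: "E = pat_env \<or> E = pat_vars" by auto
  show ?case
    using Ret by (auto simp: workload_Lam_used[OF E] fvp_with_pat split: if_splits)
next
  case (PairT x1 x2)
  then have E: "E = pat_env \<or> E = pat_vars" by auto
  show ?case
    using PairT by (auto simp: workload_Lam_used[OF E] fvp_with_pat split: if_splits)
next
  case (AddT x y)
  then have E: "E = pat_env \<or> E = pat_vars" by auto
  show ?case
    using AddT by (auto simp: workload_Lam_used[OF E] workload_plus_at[OF E] fvp_with_pat
        split: if_splits)
next
  case (ScaleT x y)
  then have E: "E = pat_env \<or> E = pat_vars" by auto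
  show ?case
    using ScaleT by (auto simp: workload_Lam_used[OF E] workload_scale_at[OF E] fvp_with_pat
        split: if_splits)
next
  case (Dup x)
  then have E: "E = pat_env \<or> E = pat_vars" by auto
  show ?case
    using Dup by (auto simp: workload_Lam_used[OF E] fvp_with_pat split: if_splits)
\<comment> \<open>The remaining translations bind only \<open>y_top\<close>, of workload 0;
  \<open>Fn f\<close> is charged 1, as is the Linear A expression.\<close>
qed (auto simp: workload_Lam_used workload_tensor_tm comp_def)

theorem proposition4:
  fixes ar :: "'f \<Rightarrow> nat" and den :: "'f \<Rightarrow> (nat \<Rightarrow> real) \<Rightarrow> real"
    and e :: "'f exp" and \<Gamma> :: "pvar set" and \<Delta> :: "tvar set" and \<theta> :: "tvar list"
    and \<tau> \<sigma> :: jty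
  assumes "signature ar den"
    and "typed ar \<Gamma> \<Delta> e \<tau> \<sigma>"
    and "distinct \<theta>" and "set \<theta> = \<Delta>"
  shows "(safe (delta e \<theta>) \<and> workload (delta e \<theta>) \<le> jax_workload e) \<and>
         (safe_bare (delta e \<theta>) \<and>
          (proper_scalings e \<longrightarrow> workload_bare (delta e \<theta>) \<le> jax_workload e))"
  using workload_delta_le[OF assms(2,4)] by (simp add: safe_delta)

end
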